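(* Generalized cuspidal edges on maxfaces or on minfaces are light-like generalized cuspidal edges of order four. That is, if a maxface or a minface in $\mathbb L^3$ is, on some coordinate neighborhood with coordinates $(s,t)\in I\times(-\delta,\delta)$, a generalized cuspidal edge $f$ along a regular curve $\Gamma$, then $\Gamma'(s)$ is light-like for all $s\in I$ and the order $i_p$ equals $4$ for every $p=(s,0)$, $s\in I$.
   Context: $\mathbb L^3$ is $\mathbb R^3$ with $\langle a,b\rangle_L=a_1b_1+a_2b_2-a_3b_3$; a vector $a\neq0$ is light-like if $\langle a,a\rangle_L=0$. A generalized cuspidal edge along $\Gamma$ is a $C^\infty$-map $f:I\times(-\delta,\delta)\to\mathbb R^3$ ($I$ an open interval, $\delta>0$) with $\Gamma(s)=f(s,0)$ a regular curve, $f_t(s,0)=0$, and $f_{tt}(s,0),\Gamma'(s)$ linearly independent for all $s\in I$. With $\Delta_L=\langle f_s,f_s\rangle_L\langle f_t,f_t\rangle_L-\langle f_s,f_t\rangle_L^2$, the order $i_p$ of $p=(s,0)$ is the smallest $k$ with $\partial^k\Delta_L/\partial t^k(s,0)\neq0$ ($\infty$ if none). A maxface is a $C^\infty$-map $f:M^2\to\mathbb L^3$ from a Riemann surface such that on an open dense subset $f$ is a conformal space-like immersion with zero mean curvature, and $df\neq0$ at every point of $M^2$. Locally, up to isometries of $\mathbb L^3$, it is the real part of the integral of a holomorphic null form given by Weierstrass data $(g,\omega)$ ($g$ meromorphic, $\omega$ a holomorphic $1$-form, $(1+|g|^2)^2|\omega|^2$ positive definite), and its first fundamental form is $(1-|g|^2)^2|\omega|^2$.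 A minface is a $C^\infty$-map $f:M^2\to\mathbb L^3$ that is a time-like immersion with zero mean curvature on an open dense subset and that near each point has coordinates $(u,v)$ in which $f(u,v)=\varphi(u)+\psi(v)$ with $\varphi,\psi$ regular curves in $\mathbb L^3$ having light-like velocity vectors (equivalently, up to isometries, it is given by a para-holomorphic Weierstrass-type representation with real data $g_1(u),g_2(v)$ and nowhere vanishing $\hat\omega_1(u),\hat\omega_2(v)$). *)

theory Defs
  imports "HOL-Analysis.Analysis" "HOL-Library.Extended_Nat"
begin

text \<open>The set \<open>S\<close> is always open below. All iterated directional derivatives exist, are
  (Frechet) differentiable and continuous.\<close>

primrec times_differentiable_on ::
    "nat \<Rightarrow> 'a::real_normed_vector set \<Rightarrow> ('a \<Rightarrow> 'b::real_normed_vector) \<Rightarrow> bool" where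
  "times_differentiable_on 0 S f \<longleftrightarrow> continuous_on S f"
| "times_differentiable_on (Suc n) S f \<longleftrightarrow>
     (\<forall>x\<in>S. f differentiable (at x)) \<and>
     (\<forall>v. times_differentiable_on n S (\<lambda>x. frechet_derivative f (at x) v))"

definition smooth_on ::
    "'a::real_normed_vector set \<Rightarrow> ('a \<Rightarrow> 'b::real_normed_vector) \<Rightarrow> bool" where
  "smooth_on S f \<longleftrightarrow> (\<forall>n. times_differentiable_on n S f)"

definition pd1 :: "(real \<times> real \<Rightarrow> 'b::real_normed_vector) \<Rightarrow> real \<times> real \<Rightarrow> 'b" where
  "pd1 F p = vector_derivative (\<lambda>x. F (x, snd p)) (at (fst p))"

definition pd2 :: "(real \<times> real \<Rightarrow> 'b::real_normed_vector) \<Rightarrow> real \<times> real \<Rightarrow> 'b" where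
  "pd2 F p = vector_derivative (\<lambda>y. F (fst p, y)) (at (snd p))"

definition open_interval :: "real set \<Rightarrow> bool" where
  "open_interval I \<longleftrightarrow> open I \<and> is_interval I \<and> I \<noteq> {}"

definition regular_curve :: "real set \<Rightarrow> (real \<Rightarrow> real^3) \<Rightarrow> bool" where
  "regular_curve I \<gamma> \<longleftrightarrow> smooth_on I \<gamma> \<and> (\<forall>s\<in>I. vector_derivative \<gamma> (at s) \<noteq> 0)"

definition lorentz :: "real^3 \<Rightarrow> real^3 \<Rightarrow> real" where
  "lorentz a b = a$1 * b$1 + a$2 * b$2 - a$3 * b$3"

definition light_like :: "real^3 \<Rightarrow> bool" where
  "light_like a \<longleftrightarrow> a \<noteq> 0 \<and> lorentz a a = 0"

text \<open>Lorentzian vector product, characterised by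
  \<open>lorentz (lorentz_cross a b) c = det (a, b, c)\<close>.\<close>

definition lorentz_cross :: "real^3 \<Rightarrow> real^3 \<Rightarrow> real^3" where
  "lorentz_cross a b = vector [cross3 a b $ 1, cross3 a b $ 2, - (cross3 a b $ 3)]"

definition spacelike_immersion_at :: "(real \<times> real \<Rightarrow> real^3) \<Rightarrow> real \<times> real \<Rightarrow> bool" where
  "spacelike_immersion_at F p \<longleftrightarrow>
     (let dF = frechet_derivative F (at p)
      in inj dF \<and> (\<forall>v. v \<noteq> 0 \<longrightarrow> lorentz (dF v) (dF v) > 0))"

text \<open>Time-like means that the induced metric on the tangent plane has signature \<open>(1,1)\<close>.\<close>

definition timelike_immersion_at :: "(real \<times> real \<Rightarrow> real^3) \<Rightarrow> real \<times> real \<Rightarrow> bool" where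
  "timelike_immersion_at F p \<longleftrightarrow>
     (let dF = frechet_derivative F (at p)
      in inj dF \<and> (\<exists>v. lorentz (dF v) (dF v) > 0) \<and> (\<exists>v. lorentz (dF v) (dF v) < 0))"

definition conformal_at :: "(real \<times> real \<Rightarrow> real^3) \<Rightarrow> real \<times> real \<Rightarrow> bool" where
  "conformal_at F p \<longleftrightarrow>
     lorentz (pd1 F p) (pd1 F p) = lorentz (pd2 F p) (pd2 F p) \<and>
     lorentz (pd1 F p) (pd2 F p) = 0"

definition Delta_L :: "(real \<times> real \<Rightarrow> real^3) \<Rightarrow> real \<times> real \<Rightarrow> real" where
  "Delta_L F p =
     lorentz (pd1 F p) (pd1 F p) * lorentz (pd2 F p) (pd2 F p) - (lorentz (pd1 F p) (pd2 F p))\<^sup>2"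

definition unit_normal :: "(real \<times> real \<Rightarrow> real^3) \<Rightarrow> real \<times> real \<Rightarrow> real^3" where
  "unit_normal F p =
     (let n = lorentz_cross (pd1 F p) (pd2 F p) in (1 / sqrt \<bar>lorentz n n\<bar>) *\<^sub>R n)"

text \<open>Only meaningful where \<open>Delta_L F p \<noteq> 0\<close>. The sign depends on the choice of the normal
  (and, by convention, on its causal character); only the vanishing of \<open>mean_curvature\<close> is used,
  which is independent of this and of the coordinates.\<close>

definition mean_curvature :: "(real \<times> real \<Rightarrow> real^3) \<Rightarrow> real \<times> real \<Rightarrow> real" where
  "mean_curvature F p =
     (let \<nu> = unit_normal F p;
          g11 = lorentz (pd1 F p) (pd1 F p);
          g12 = lorentz (pd1 F p) (pd2 F p);
          g22 = lorentz (pd2 F p) (pd2 F p);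
          h11 = lorentz (pd1 (pd1 F) p) \<nu>;
          h12 = lorentz (pd2 (pd1 F) p) \<nu>;
          h22 = lorentz (pd2 (pd2 F) p) \<nu>
      in (g11 * h22 - 2 * g12 * h12 + g22 * h11) / (2 * (g11 * g22 - g12\<^sup>2)))"

text \<open>A local parametrization \<open>(D, X)\<close> is the inverse of a chart. Atlases are sets of
  local parametrizations, and \<open>\<complex>\<close> is identified with \<open>\<real> \<times> \<real>\<close>
  so that smooth and complex atlases share one type.\<close>

type_synonym 'a param = "(real \<times> real) set \<times> (real \<times> real \<Rightarrow> 'a)"

definition local_param :: "'a topology \<Rightarrow> 'a param \<Rightarrow> bool" where
  "local_param M P \<longleftrightarrow> (case P of (D, X) \<Rightarrow>
     open D \<and> openin M (X ` D) \<and>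
     homeomorphic_map (top_of_set D) (subtopology M (X ` D)) X)"

definition overlap :: "'a param \<Rightarrow> 'a param \<Rightarrow> (real \<times> real) set" where
  "overlap P Q = {p \<in> fst P. snd P p \<in> snd Q ` fst Q}"

definition transition :: "'a param \<Rightarrow> 'a param \<Rightarrow> real \<times> real \<Rightarrow> real \<times> real" where
  "transition P Q p = inv_into (fst Q) (snd Q) (snd P p)"

definition smooth_surface :: "'a topology \<Rightarrow> 'a param set \<Rightarrow> bool" where
  "smooth_surface M A \<longleftrightarrow>
     Hausdorff_space M \<and> second_countable M \<and>
     (\<forall>P\<in>A. local_param M P) \<and>
     (\<Union>(D, X)\<in>A. X ` D) = topspace M \<and>
     (\<forall>P\<in>A. \<forall>Q\<in>A. smooth_on (overlap P Q) (transition P Q))"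

definition to_complex :: "real \<times> real \<Rightarrow> complex" where
  "to_complex p = Complex (fst p) (snd p)"

definition riemann_surface :: "'a topology \<Rightarrow> 'a param set \<Rightarrow> bool" where
  "riemann_surface M A \<longleftrightarrow>
     smooth_surface M A \<and>
     (\<forall>P\<in>A. \<forall>Q\<in>A. (\<lambda>z. to_complex (transition P Q (Re z, Im z)))
        holomorphic_on (to_complex ` overlap P Q))"

text \<open>Local coordinates compatible with the smooth structure only: on a Riemann surface they need
  not be complex coordinates.\<close>

definition smooth_coordinates :: "'a topology \<Rightarrow> 'a param set \<Rightarrow> 'a param \<Rightarrow> bool" where
  "smooth_coordinates M A P \<longleftrightarrow>
     local_param M P \<and>
     (\<forall>Q\<in>A. smooth_on (overlap P Q) (transition P Q) \<and> smooth_on (overlap Q P) (transition Q P))"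

definition smooth_map :: "'a param set \<Rightarrow> ('a \<Rightarrow> real^3) \<Rightarrow> bool" where
  "smooth_map A f \<longleftrightarrow> (\<forall>(D, X)\<in>A. smooth_on D (f \<circ> X))"

definition open_dense_in :: "'a topology \<Rightarrow> 'a set \<Rightarrow> bool" where
  "open_dense_in M W \<longleftrightarrow> openin M W \<and> M closure_of W = topspace M"

definition maxface :: "'a topology \<Rightarrow> 'a param set \<Rightarrow> ('a \<Rightarrow> real^3) \<Rightarrow> bool" where
  "maxface M A f \<longleftrightarrow>
     riemann_surface M A \<and> smooth_map A f \<and>
     (\<exists>W. open_dense_in M W \<and>
        (\<forall>(D, X)\<in>A. \<forall>p\<in>D. X p \<in> W \<longrightarrow>
           spacelike_immersion_at (f \<circ> X) p \<and> conformal_at (f \<circ> X) p \<and>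
           mean_curvature (f \<circ> X) p = 0)) \<and>
     (\<forall>(D, X)\<in>A. \<forall>p\<in>D. frechet_derivative (f \<circ> X) (at p) \<noteq> (\<lambda>v. 0))"

definition minface :: "'a topology \<Rightarrow> 'a param set \<Rightarrow> ('a \<Rightarrow> real^3) \<Rightarrow> bool" where
  "minface M A f \<longleftrightarrow>
     smooth_surface M A \<and> smooth_map A f \<and>
     (\<exists>W. open_dense_in M W \<and>
        (\<forall>(D, X)\<in>A. \<forall>p\<in>D. X p \<in> W \<longrightarrow>
           timelike_immersion_at (f \<circ> X) p \<and> mean_curvature (f \<circ> X) p = 0)) \<and>
     (\<forall>x\<in>topspace M. \<exists>J K Y \<phi> \<psi>.
        open_interval J \<and> open_interval K \<and>
        smooth_coordinates M A (J \<times> K, Y) \<and> x \<in> Y ` (J \<times> K) \<and>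
        regular_curve J \<phi> \<and> (\<forall>u\<in>J. light_like (vector_derivative \<phi> (at u))) \<and>
        regular_curve K \<psi> \<and> (\<forall>v\<in>K. light_like (vector_derivative \<psi> (at v))) \<and>
        (\<forall>u\<in>J. \<forall>v\<in>K. f (Y (u, v)) = \<phi> u + \<psi> v))"

definition generalized_cuspidal_edge ::
    "real set \<Rightarrow> real \<Rightarrow> (real \<Rightarrow> real^3) \<Rightarrow> (real \<times> real \<Rightarrow> real^3) \<Rightarrow> bool" where
  "generalized_cuspidal_edge I \<delta> \<Gamma> F \<longleftrightarrow>
     open_interval I \<and> \<delta> > 0 \<and>
     smooth_on (I \<times> {-\<delta><..<\<delta>}) F \<and>
     (\<forall>s\<in>I. \<Gamma> s = F (s, 0)) \<and> regular_curve I \<Gamma> \<and>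
     (\<forall>s\<in>I. pd2 F (s, 0) = 0) \<and>
     (\<forall>s\<in>I. pd2 (pd2 F) (s, 0) \<noteq> vector_derivative \<Gamma> (at s) \<and>
            independent {pd2 (pd2 F) (s, 0), vector_derivative \<Gamma> (at s)})"

definition order_at :: "(real \<times> real \<Rightarrow> real^3) \<Rightarrow> real \<Rightarrow> enat" where
  "order_at F s =
     (if \<exists>k. (pd2 ^^ k) (Delta_L F) (s, 0) \<noteq> 0
      then enat (LEAST k. (pd2 ^^ k) (Delta_L F) (s, 0) \<noteq> 0)
      else \<infinity>)"

end

theory Submission
  imports Defs
begin

text \<open>The result is a consequence of the conformal structure behind the surface. On a maxface the induced
  (possibly degenerate) metric is everywhere a multiple of \<open>du\<^sup>2 + dv\<^sup>2\<close>: this holds by assumption on an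
  open dense set and extends by continuity. On a minface written as \<open>\<phi>(u) + \<psi>(v)\<close> with null
  velocities it is a multiple of \<open>du dv\<close>. In both cases it is \<open>\<rho> Q\<close>, where \<open>Q\<close> is a field of
  nondegenerate quadratic forms and the differential of the surface kills no nonzero \<open>Q\<close>-null vector
  (for a minface these vectors are multiples of \<open>\<partial>\<^sub>u\<close> and \<open>\<partial>\<^sub>v\<close>, and \<open>\<phi>'\<close>, \<open>\<psi>'\<close> do not vanish). This
  property survives changes of coordinates (\<open>conformal_to_form_near_transport\<close>), so it can be used in the
  coordinates \<open>(s, t)\<close> of the cuspidal edge (\<open>smooth_coordinates_conformal_to_form_near\<close>).

  Write \<open>Q = e ds\<^sup>2 + 2 m ds dt + g dt\<^sup>2\<close> there. Since \<open>f\<^sub>t\<close> vanishes on the edge, \<open>\<partial>\<^sub>t\<close> is not \<open>Q\<close>-null,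
  that is \<open>g \<noteq> 0\<close>, and with \<open>G = \<langle>f\<^sub>t, f\<^sub>t\<rangle>\<close> near the edge
  \<open>\<langle>f\<^sub>s, f\<^sub>s\<rangle> = (e/g) G\<close>, \<open>\<langle>f\<^sub>s, f\<^sub>t\<rangle> = (m/g) G\<close> and \<open>\<Delta>\<^sub>L = G\<^sup>2 (e g - m\<^sup>2) / g\<^sup>2\<close>.
  The first equation at \<open>t = 0\<close> says that \<open>\<Gamma>'\<close> is null; the second, divided by \<open>t\<close>, gives
  \<open>\<langle>\<Gamma>', f\<^sub>t\<^sub>t\<rangle> = 0\<close> in the limit. A vector that is orthogonal to a null vector and not a multiple of it is
  not null, so \<open>\<langle>f\<^sub>t\<^sub>t, f\<^sub>t\<^sub>t\<rangle> \<noteq> 0\<close>. Hence \<open>G\<close> vanishes to order exactly two in \<open>t\<close>, and by the third equation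
  \<open>\<Delta>\<^sub>L / t\<^sup>4\<close> has a nonzero limit; since \<open>\<Delta>\<^sub>L\<close> is smooth, its order is four.\<close>

section \<open>Smooth maps\<close>

lemma times_differentiable_on_cong:
  assumes "open S" "\<And>x. x \<in> S \<Longrightarrow> f x = g x" "times_differentiable_on n S f"
  shows "times_differentiable_on n S g"
  using assms(2,3)
proof (induction n arbitrary: f g)
  case 0
  then show ?case
    by (simp cong: continuous_on_cong)
next
  case (Suc n)
  have d: "g differentiable (at x)" "frechet_derivative g (at x) = frechet_derivative f (at x)"
    if "x \<in> S" for x
  proof -
    have "(f has_derivative frechet_derivative f (at x)) (at x)"
      using Suc.prems that by (simp add: frechet_derivative_works)
    then have "(g has_derivative frechet_derivative f (at x)) (at x)"
      by (rule has_derivative_transform_within_open[OF _ assms(1) that]) (use Suc.prems in auto)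
    then show "g differentiable (at x)" "frechet_derivative g (at x) = frechet_derivative f (at x)"
      using frechet_derivative_at differentiableI by metis+
  qed
  have "times_differentiable_on n S (\<lambda>x. frechet_derivative g (at x) v)" for v
    by (rule Suc.IH[of "\<lambda>x. frechet_derivative f (at x) v"]) (use Suc.prems d in auto)
  then show ?case
    using d by simp
qed

lemma smooth_on_cong:
  assumes "open S" "\<And>x. x \<in> S \<Longrightarrow> f x = g x" "smooth_on S f"
  shows "smooth_on S g"
  using assms times_differentiable_on_cong unfolding smooth_on_def by blast

lemma smooth_on_has_derivative:
  assumes "smooth_on S f" "x \<in> S"
  shows "(f has_derivative frechet_derivative f (at x)) (at x)"
proof -
  have "times_differentiable_on (Suc 0) S f"
    using assms(1) smooth_on_def by blast
  then show ?thesis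
    using assms(2) by (simp add: frechet_derivative_works)
qed

lemma smooth_on_frechet_derivative:
  assumes "smooth_on S f"
  shows "smooth_on S (\<lambda>x. frechet_derivative f (at x) v)"
proof -
  have "times_differentiable_on (Suc n) S f" for n
    using assms smooth_on_def by blast
  then show ?thesis
    unfolding smooth_on_def by simp
qed

lemma smooth_on_isCont:
  assumes "smooth_on S f" "x \<in> S"
  shows "isCont f x"
  using smooth_on_has_derivative[OF assms] has_derivative_continuous by blast

lemma times_differentiable_on_add:
  assumes "open S" "times_differentiable_on n S f" "times_differentiable_on n S g"
  shows "times_differentiable_on n S (\<lambda>x. f x + g x)"
  using assms(2,3)
proof (induction n arbitrary: f g)
  case 0
  then show ?case
    by (simp add: continuous_on_add)
next
  case (Suc n)
  have d: "((\<lambda>x. f x + g x) has_derivative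
      (\<lambda>v. frechet_derivative f (at x) v + frechet_derivative g (at x) v)) (at x)" if "x \<in> S" for x
    using Suc.prems that by (intro has_derivative_add) (simp_all add: frechet_derivative_works)
  have "times_differentiable_on n S (\<lambda>x. frechet_derivative (\<lambda>x. f x + g x) (at x) v)" for v
  proof (rule times_differentiable_on_cong[OF assms(1) _ Suc.IH])
    show "frechet_derivative f (at x) v + frechet_derivative g (at x) v =
        frechet_derivative (\<lambda>x. f x + g x) (at x) v" if "x \<in> S" for x
      using frechet_derivative_at[OF d[OF that]] by metis
  qed (use Suc.prems in auto)
  then show ?case
    using d by (auto simp: differentiable_def)
qed

text \<open>The induction runs over the order of differentiability for all pairs of smooth maps at once: by the
  Leibniz rule a directional derivative is a sum of two terms that are again of the form
  \<open>b\<close> applied to smooth maps.\<close>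

lemma smooth_on_bilinear:
  assumes "bounded_bilinear b" "open S" "smooth_on S f" "smooth_on S g"
  shows "smooth_on S (\<lambda>x. b (f x) (g x))"
proof -
  interpret bounded_bilinear b by fact
  have "times_differentiable_on n S (\<lambda>x. b (f x) (g x))" for n
    using assms(3,4)
  proof (induction n arbitrary: f g)
    case 0
    then show ?case
      unfolding times_differentiable_on.simps
      by (intro continuous_on continuous_at_imp_continuous_on ballI) (auto intro: smooth_on_isCont)
  next
    case (Suc n)
    have d: "((\<lambda>x. b (f x) (g x)) has_derivative (\<lambda>v. b (f x) (frechet_derivative g (at x) v)
        + b (frechet_derivative f (at x) v) (g x))) (at x)" if "x \<in> S" for x
      using Suc.prems that by (intro FDERIV smooth_on_has_derivative)
    have "times_differentiable_on n S (\<lambda>x. frechet_derivative (\<lambda>x. b (f x) (g x)) (at x) v)" for v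
    proof (rule times_differentiable_on_cong[OF assms(2) _ times_differentiable_on_add[OF assms(2)]])
      show "b (f x) (frechet_derivative g (at x) v) + b (frechet_derivative f (at x) v) (g x) =
          frechet_derivative (\<lambda>x. b (f x) (g x)) (at x) v" if "x \<in> S" for x
        using frechet_derivative_at[OF d[OF that]] by metis
    qed (intro Suc smooth_on_frechet_derivative)+
    then show ?case
      using d by (auto simp: differentiable_def)
  qed
  then show ?thesis
    by (simp add: smooth_on_def)
qed

lemma smooth_on_add:
  assumes "open S" "smooth_on S f" "smooth_on S g"
  shows "smooth_on S (\<lambda>x. f x + g x)"
  using assms times_differentiable_on_add unfolding smooth_on_def by blast

lemma has_vector_derivative_partial1:
  assumes "(F has_derivative D) (at (s, t))"
  shows "((\<lambda>x. F (x, t)) has_vector_derivative D (1, 0)) (at s)"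
proof -
  interpret bounded_linear D
    using assms by (rule has_derivative_bounded_linear)
  have "((\<lambda>x. (x, t)) has_derivative (\<lambda>h. (h, 0))) (at s)"
    by (auto intro!: derivative_eq_intros)
  from has_derivative_compose[OF this assms]
  have "((\<lambda>x. F (x, t)) has_derivative (\<lambda>h. D (h, 0))) (at s)" .
  moreover have "(\<lambda>h. D (h, 0)) = (\<lambda>h. h *\<^sub>R D (1, 0))"
  proof
    show "D (h, 0) = h *\<^sub>R D (1, 0)" for h
      using scaleR[of h "(1, 0)"] by simp
  qed
  ultimately show ?thesis
    by (simp only: has_vector_derivative_def)
qed

lemma has_vector_derivative_partial2:
  assumes "(F has_derivative D) (at (s, t))"
  shows "((\<lambda>y. F (s, y)) has_vector_derivative D (0, 1)) (at t)"
proof -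
  interpret bounded_linear D
    using assms by (rule has_derivative_bounded_linear)
  have "((\<lambda>y. (s, y)) has_derivative (\<lambda>h. (0, h))) (at t)"
    by (auto intro!: derivative_eq_intros)
  from has_derivative_compose[OF this assms]
  have "((\<lambda>y. F (s, y)) has_derivative (\<lambda>h. D (0, h))) (at t)" .
  moreover have "(\<lambda>h. D (0, h)) = (\<lambda>h. h *\<^sub>R D (0, 1))"
  proof
    show "D (0, h) = h *\<^sub>R D (0, 1)" for h
      using scaleR[of h "(0, 1)"] by simp
  qed
  ultimately show ?thesis
    by (simp only: has_vector_derivative_def)
qed

lemma pd1_eq_derivative:
  "(F has_derivative D) (at p) \<Longrightarrow> pd1 F p = D (1, 0)"
  unfolding pd1_def using has_vector_derivative_partial1[of F D "fst p" "snd p"]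
  by (simp add: vector_derivative_at)

lemma pd2_eq_derivative:
  "(F has_derivative D) (at p) \<Longrightarrow> pd2 F p = D (0, 1)"
  unfolding pd2_def using has_vector_derivative_partial2[of F D "fst p" "snd p"]
  by (simp add: vector_derivative_at)

lemma smooth_on_pd1:
  assumes "open S" "smooth_on S F"
  shows "smooth_on S (pd1 F)"
  by (rule smooth_on_cong[OF assms(1) _ smooth_on_frechet_derivative[OF assms(2), of "(1, 0)"]])
    (use assms pd1_eq_derivative smooth_on_has_derivative in metis)

lemma smooth_on_pd2:
  assumes "open S" "smooth_on S F"
  shows "smooth_on S (pd2 F)"
  by (rule smooth_on_cong[OF assms(1) _ smooth_on_frechet_derivative[OF assms(2), of "(0, 1)"]])
    (use assms pd2_eq_derivative smooth_on_has_derivative in metis)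

lemma smooth_on_pd2_iterate:
  assumes "open S" "smooth_on S F"
  shows "smooth_on S ((pd2 ^^ k) F)"
  by (induction k) (use assms in \<open>auto intro: smooth_on_pd2\<close>)

lemma has_vector_derivative_pd2:
  assumes "smooth_on S F" "(s, t) \<in> S"
  shows "((\<lambda>y. F (s, y)) has_vector_derivative pd2 F (s, t)) (at t)"
  using has_vector_derivative_partial2[OF smooth_on_has_derivative[OF assms]]
    pd2_eq_derivative[OF smooth_on_has_derivative[OF assms]] by simp

section \<open>The Lorentzian inner product\<close>

lemma bounded_bilinear_lorentz: "bounded_bilinear lorentz"
proof
  fix a a' b b' :: "real^3" and r :: real
  show "lorentz (a + a') b = lorentz a b + lorentz a' b"
    "lorentz a (b + b') = lorentz a b + lorentz a b'"
    "lorentz (r *\<^sub>R a) b = r *\<^sub>R lorentz a b" "lorentz a (r *\<^sub>R b) = r *\<^sub>R lorentz a b"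
    by (auto simp: lorentz_def algebra_simps)
  show "\<exists>K. \<forall>a b. norm (lorentz a b) \<le> norm a * norm b * K"
  proof (intro exI allI)
    fix a b :: "real^3"
    have c: "\<bar>a $ i * b $ i\<bar> \<le> norm a * norm b" for i
      unfolding abs_mult by (intro mult_mono component_le_norm_cart) auto
    show "norm (lorentz a b) \<le> norm a * norm b * 3"
      using c[of 1] c[of 2] c[of 3] by (simp add: lorentz_def)
  qed
qed

lemma lorentz_combination:
  "lorentz (x *\<^sub>R a + y *\<^sub>R b) (x *\<^sub>R a + y *\<^sub>R b)
    = x\<^sup>2 * lorentz a a + 2 * x * y * lorentz a b + y\<^sup>2 * lorentz b b"
  by (simp add: lorentz_def algebra_simps power2_eq_square)

text \<open>The equality case of the Cauchy-Schwarz inequality for the first two coordinates: the squared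
  distance of the planar vectors \<open>l\<^sub>3 (w\<^sub>1, w\<^sub>2)\<close> and \<open>w\<^sub>3 (l\<^sub>1, l\<^sub>2)\<close> is
  \<open>2 l\<^sub>3\<^sup>2 w\<^sub>3\<^sup>2 - 2 l\<^sub>3\<^sup>2 w\<^sub>3\<^sup>2\<close>.\<close>

lemma null_orthogonal_imp_dependent:
  assumes L: "light_like l" and orth: "lorentz l w = 0" and null: "lorentz w w = 0"
  shows "\<exists>c. w = c *\<^sub>R l"
proof -
  have n: "l$3 * l$3 = l$1 * l$1 + l$2 * l$2" "w$3 * w$3 = w$1 * w$1 + w$2 * w$2"
      "l$3 * w$3 = l$1 * w$1 + l$2 * w$2"
    using assms by (auto simp: lorentz_def light_like_def)
  have l3: "l$3 \<noteq> 0"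
  proof
    assume "l$3 = 0"
    then have "l$1 = 0" "l$2 = 0"
      using n(1) by (auto simp: sum_squares_eq_zero_iff)
    then have "l = 0"
      using \<open>l$3 = 0\<close> by (simp add: vec_eq_iff forall_3)
    then show False
      using L by (simp add: light_like_def)
  qed
  have "(l$3 * w$1 - w$3 * l$1)\<^sup>2 + (l$3 * w$2 - w$3 * l$2)\<^sup>2
      = (l$3 * l$3) * (w$1 * w$1 + w$2 * w$2) + (w$3 * w$3) * (l$1 * l$1 + l$2 * l$2)
        - 2 * (l$3 * w$3) * (l$1 * w$1 + l$2 * w$2)"
    by (simp add: power2_eq_square algebra_simps)
  also have "\<dots> = 0"
    unfolding n(1,2)[symmetric] n(3)[symmetric] by simp
  finally have "l$3 * w$1 = w$3 * l$1" "l$3 * w$2 = w$3 * l$2"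
    by (auto simp: sum_power2_eq_zero_iff)
  then have "w = (w$3 / l$3) *\<^sub>R l"
    using l3 by (simp add: vec_eq_iff forall_3 field_simps)
  then show ?thesis ..
qed

section \<open>Order of vanishing\<close>

text \<open>The \<open>h k\<close> are the successive derivatives of \<open>h 0\<close>. As soon as the derivatives of order below \<open>k\<close>
  vanish at \<open>0\<close>, Taylor's formula reads \<open>h 0 t / t ^ k = h k \<xi> / fact k\<close> with \<open>\<xi>\<close> between \<open>0\<close> and \<open>t\<close>,
  and the limit \<open>t \<rightarrow> 0\<close> determines \<open>h k 0\<close>.\<close>

lemma derivatives_from_leading_term:
  fixes h :: "nat \<Rightarrow> real \<Rightarrow> real"
  assumes "\<delta> > 0"
    and deriv: "\<And>k t. \<bar>t\<bar> < \<delta> \<Longrightarrow> (h k has_real_derivative h (Suc k) t) (at t)"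
    and lim: "((\<lambda>t. h 0 t / t ^ n) \<longlongrightarrow> L) (at 0)"
  shows "(\<forall>k<n. h k 0 = 0) \<and> h n 0 = fact n * L"
proof -
  have step: "h k 0 = fact k * C"
    if zero: "\<forall>j<k. h j 0 = 0" and C: "((\<lambda>t. h 0 t / t ^ k) \<longlongrightarrow> C) (at 0)" for k C
  proof -
    have ex: "\<exists>\<xi>. \<bar>\<xi>\<bar> \<le> \<bar>t\<bar> \<and> h 0 t = h k \<xi> / fact k * t ^ k" if "\<bar>t\<bar> < \<delta>" for t
    proof -
      have "\<exists>\<xi>. \<bar>\<xi>\<bar> \<le> \<bar>t\<bar> \<and> h 0 t = (\<Sum>j<k. h j 0 / fact j * t ^ j) + h k \<xi> / fact k * t ^ k"
        by (rule Maclaurin_bi_le) (use that deriv in auto)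
      then show ?thesis
        using zero by simp
    qed
    \<comment> \<open>a choice of intermediate points, made on the whole line so that their limit can be taken\<close>
    define \<xi> where "\<xi> t = (SOME x. \<bar>x\<bar> \<le> \<bar>t\<bar> \<and> h 0 t = h k x / fact k * t ^ k)" for t
    have \<xi>: "\<bar>\<xi> t\<bar> \<le> \<bar>t\<bar>" "h 0 t = h k (\<xi> t) / fact k * t ^ k" if "\<bar>t\<bar> < \<delta>" for t
      using someI_ex[OF ex[OF that]] unfolding \<xi>_def by auto
    have near: "eventually (\<lambda>t. \<bar>t\<bar> < \<delta> \<and> t \<noteq> 0) (at (0::real))"
      using \<open>\<delta> > 0\<close> by (auto simp: eventually_at dist_real_def)
    have "(\<xi> \<longlongrightarrow> 0) (at 0)"
    proof (rule Lim_null_comparison)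
      show "eventually (\<lambda>t. norm (\<xi> t) \<le> \<bar>t\<bar>) (at 0)"
        using near by eventually_elim (use \<xi> in auto)
      show "((\<lambda>t::real. \<bar>t\<bar>) \<longlongrightarrow> 0) (at 0)"
        by (intro tendsto_rabs_zero tendsto_ident_at)
    qed
    moreover have "isCont (h k) 0"
      using deriv[of 0 k] \<open>\<delta> > 0\<close> DERIV_isCont by auto
    ultimately have "((\<lambda>t. h k (\<xi> t) / fact k) \<longlongrightarrow> h k 0 / fact k) (at 0)"
      by (intro tendsto_divide isCont_tendsto_compose[of 0 "h k"]) auto
    moreover have "eventually (\<lambda>t. h k (\<xi> t) / fact k = h 0 t / t ^ k) (at 0)"
      using near by eventually_elim (use \<xi>(2) in auto)
    ultimately have "((\<lambda>t. h 0 t / t ^ k) \<longlongrightarrow> h k 0 / fact k) (at 0)"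
      using tendsto_cong by fast
    then have "h k 0 / fact k = C"
      using C by (intro tendsto_unique) auto
    then show ?thesis
      by (auto simp: field_simps)
  qed
  have zero: "h k 0 = 0" if "k < n" for k
    using that
  proof (induction k rule: less_induct)
    case (less k)
    have "((\<lambda>t. h 0 t / t ^ n * t ^ (n - k)) \<longlongrightarrow> L * 0 ^ (n - k)) (at 0)"
      by (intro tendsto_intros lim)
    moreover have "eventually (\<lambda>t. h 0 t / t ^ n * t ^ (n - k) = h 0 t / t ^ k) (at 0)"
      using less.prems by (auto simp: eventually_at_filter power_diff)
    ultimately have "((\<lambda>t. h 0 t / t ^ k) \<longlongrightarrow> 0) (at 0)"
      using less.prems tendsto_cong by (fastforce simp: power_0_left)
    then show ?case
      using step[of k 0] less by simp
  qed
  then show ?thesis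
    using step[of n L] lim by simp
qed

section \<open>Maps conformal to a nondegenerate quadratic form\<close>

definition qform :: "real \<Rightarrow> real \<Rightarrow> real \<Rightarrow> real \<times> real \<Rightarrow> real" where
  "qform e m g w = e * (fst w)\<^sup>2 + 2 * m * fst w * snd w + g * (snd w)\<^sup>2"

text \<open>The coordinate-independent substitute for conformal and for null coordinates: signature \<open>(2,0)\<close> of
  the form covers maxfaces, signature \<open>(1,1)\<close> minfaces. Continuity of the coefficients at
  the one point \<open>p\<close> is what the limits \<open>t \<rightarrow> 0\<close> require. The multiplier \<open>\<rho>\<close> is zero where the
  induced metric degenerates. The last clause makes the direction killed by the differential at a
  singular point non-null for the form.\<close>

definition conformal_to_form_near :: "(real \<times> real \<Rightarrow> real^3) \<Rightarrow> real \<times> real \<Rightarrow> bool" where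
  "conformal_to_form_near F p \<longleftrightarrow>
     (\<exists>U e m g \<rho>. open U \<and> p \<in> U \<and> isCont e p \<and> isCont m p \<and> isCont g p \<and>
        e p * g p - (m p)\<^sup>2 \<noteq> 0 \<and>
        (\<forall>q\<in>U. F differentiable (at q) \<and>
           (\<forall>w. lorentz (frechet_derivative F (at q) w) (frechet_derivative F (at q) w)
              = \<rho> q * qform (e q) (m q) (g q) w)) \<and>
        (\<forall>w. w \<noteq> 0 \<and> qform (e p) (m p) (g p) w = 0 \<longrightarrow> frechet_derivative F (at p) w \<noteq> 0))"

lemma linear_plane:
  fixes T :: "real \<times> real \<Rightarrow> 'b::real_vector"
  assumes "linear T"
  shows "T w = fst w *\<^sub>R T (1, 0) + snd w *\<^sub>R T (0, 1)"
proof -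
  have "T w = T (fst w *\<^sub>R (1, 0) + snd w *\<^sub>R (0, 1))"
    by (simp add: prod_eq_iff)
  then show ?thesis
    using assms by (simp only: linear_add linear_scale)
qed

lemma inj_plane_imp_det_nonzero:
  fixes T :: "real \<times> real \<Rightarrow> real \<times> real"
  assumes "linear T" "inj T"
  shows "fst (T (1, 0)) * snd (T (0, 1)) - fst (T (0, 1)) * snd (T (1, 0)) \<noteq> 0"
proof
  let ?a = "fst (T (1, 0))" and ?b = "fst (T (0, 1))"
    and ?c = "snd (T (1, 0))" and ?d = "snd (T (0, 1))"
  assume z: "?a * ?d - ?b * ?c = 0"
  have ker: "w = 0" if "T w = 0" for w
    using assms that linear_injective_0 by blast
  have "T (?d, - ?c) = 0" "T (?b, - ?a) = 0"
    using z by (subst linear_plane[OF assms(1)], simp add: prod_eq_iff algebra_simps)+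
  then have "?c = 0" "?a = 0"
    using ker by (fastforce simp: zero_prod_def)+
  then have "T (1, 0) = 0"
    by (simp add: prod_eq_iff)
  then show False
    using ker by (fastforce simp: zero_prod_def)
qed

text \<open>The form is pulled back along \<open>\<tau>\<close>; its determinant gets multiplied by the squared Jacobian of \<open>\<tau>\<close>.\<close>

lemma conformal_to_form_near_transport:
  assumes G: "conformal_to_form_near G (\<tau> p)"
    and U: "open U" "p \<in> U" and \<tau>: "smooth_on U \<tau>"
    and inj: "inj (frechet_derivative \<tau> (at p))"
    and F: "\<And>q. q \<in> U \<Longrightarrow> F q = G (\<tau> q)"
  shows "conformal_to_form_near F p"
proof -
  obtain V e m g \<rho> where V: "open V" "\<tau> p \<in> V"
    and cont: "isCont e (\<tau> p)" "isCont m (\<tau> p)" "isCont g (\<tau> p)"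
    and nondeg: "e (\<tau> p) * g (\<tau> p) - (m (\<tau> p))\<^sup>2 \<noteq> 0"
    and diff: "\<And>q. q \<in> V \<Longrightarrow> G differentiable (at q)"
    and form: "\<And>q w. q \<in> V \<Longrightarrow> lorentz (frechet_derivative G (at q) w) (frechet_derivative G (at q) w)
              = \<rho> q * qform (e q) (m q) (g q) w"
    and null: "\<And>w. w \<noteq> 0 \<Longrightarrow> qform (e (\<tau> p)) (m (\<tau> p)) (g (\<tau> p)) w = 0 \<Longrightarrow>
              frechet_derivative G (at (\<tau> p)) w \<noteq> 0"
    using G unfolding conformal_to_form_near_def by blast
  define T where "T q = frechet_derivative \<tau> (at q)" for q
  have T: "(\<tau> has_derivative T q) (at q)" if "q \<in> U" for q
    unfolding T_def using smooth_on_has_derivative[OF \<tau> that] .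
  have linT: "linear (T q)" if "q \<in> U" for q
    using T[OF that] has_derivative_linear by blast
  define U' where "U' = U \<inter> \<tau> -` V"
  have "continuous_on U \<tau>"
    using \<tau> by (auto intro!: continuous_at_imp_continuous_on smooth_on_isCont)
  then have U': "open U'" "p \<in> U'"
    unfolding U'_def using U V by (auto intro: continuous_open_preimage)
  have DF: "(F has_derivative (\<lambda>w. frechet_derivative G (at (\<tau> q)) (T q w))) (at q)" if "q \<in> U'" for q
  proof -
    have "((\<lambda>q. G (\<tau> q)) has_derivative (\<lambda>w. frechet_derivative G (at (\<tau> q)) (T q w))) (at q)"
      by (rule has_derivative_compose[OF T])
        (use that diff in \<open>auto simp: U'_def frechet_derivative_works\<close>)
    then show ?thesis
      by (rule has_derivative_transform_within_open[OF _ U(1)]) (use that F in \<open>auto simp: U'_def\<close>)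
  qed
  have dF: "frechet_derivative F (at q) = (\<lambda>w. frechet_derivative G (at (\<tau> q)) (T q w))"
    if "q \<in> U'" for q
    by (rule frechet_derivative_at[OF DF[OF that], symmetric])
  define a b c d where "a q = fst (T q (1, 0))" and "b q = fst (T q (0, 1))"
    and "c q = snd (T q (1, 0))" and "d q = snd (T q (0, 1))" for q
  have Tcont: "isCont (\<lambda>q. T q w) p" for w
    unfolding T_def by (rule smooth_on_isCont[OF smooth_on_frechet_derivative[OF \<tau>] U(2)])
  have abcd: "isCont a p" "isCont b p" "isCont c p" "isCont d p"
    unfolding a_def b_def c_def d_def by (intro continuous_intros Tcont)+
  have \<tau>cont: "isCont \<tau> p"
    using smooth_on_isCont[OF \<tau> U(2)] .
  have cont': "isCont (\<lambda>q. e (\<tau> q)) p" "isCont (\<lambda>q. m (\<tau> q)) p" "isCont (\<lambda>q. g (\<tau> q)) p"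
    using \<tau>cont cont by (auto intro: isCont_o2)
  define e' m' g' where
    "e' q = e (\<tau> q) * (a q)\<^sup>2 + 2 * m (\<tau> q) * a q * c q + g (\<tau> q) * (c q)\<^sup>2" and
    "m' q = e (\<tau> q) * a q * b q + m (\<tau> q) * (a q * d q + b q * c q) + g (\<tau> q) * c q * d q" and
    "g' q = e (\<tau> q) * (b q)\<^sup>2 + 2 * m (\<tau> q) * b q * d q + g (\<tau> q) * (d q)\<^sup>2" for q
  have pull: "qform (e (\<tau> q)) (m (\<tau> q)) (g (\<tau> q)) (T q w) = qform (e' q) (m' q) (g' q) w"
    if "q \<in> U" for q w
    unfolding linear_plane[OF linT[OF that], of w]
    by (simp add: qform_def e'_def m'_def g'_def a_def b_def c_def d_def
        power2_eq_square algebra_simps)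
  have "e' p * g' p - (m' p)\<^sup>2 = (a p * d p - b p * c p)\<^sup>2 * (e (\<tau> p) * g (\<tau> p) - (m (\<tau> p))\<^sup>2)"
    by (simp add: e'_def m'_def g'_def power2_eq_square algebra_simps)
  moreover have "a p * d p - b p * c p \<noteq> 0"
    unfolding a_def b_def c_def d_def
    by (rule inj_plane_imp_det_nonzero) (use linT U inj in \<open>auto simp: T_def\<close>)
  ultimately have nondeg': "e' p * g' p - (m' p)\<^sup>2 \<noteq> 0"
    using nondeg by simp
  have cont'': "isCont e' p" "isCont m' p" "isCont g' p"
    unfolding e'_def m'_def g'_def by (intro continuous_intros abcd cont')+
  have null': "frechet_derivative F (at p) w \<noteq> 0" if "w \<noteq> 0" "qform (e' p) (m' p) (g' p) w = 0" for w
  proof -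
    have "T p w \<noteq> 0"
      using linT[OF U(2)] linear_injective_0 inj that(1) unfolding T_def by blast
    then show ?thesis
      using null pull[OF U(2)] that dF[OF U'(2)] by auto
  qed
  show ?thesis
    unfolding conformal_to_form_near_def
  proof (intro exI conjI ballI allI)
    fix q w
    assume q: "q \<in> U'"
    show "F differentiable (at q)"
      using DF[OF q] differentiableI by blast
    show "lorentz (frechet_derivative F (at q) w) (frechet_derivative F (at q) w)
        = (\<rho> \<circ> \<tau>) q * qform (e' q) (m' q) (g' q) w"
      using q form pull dF[OF q] by (simp add: U'_def)
  qed (use U' cont'' nondeg' null' in auto)
qed

section \<open>Changes of coordinates\<close>

lemma local_param_openin_image:
  assumes "local_param M (D, X)" "open V" "V \<subseteq> D"
  shows "openin M (X ` V)"
proof -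
  have "open_map (top_of_set D) (subtopology M (X ` D)) X" "openin M (X ` D)"
    using assms(1) by (auto simp: local_param_def homeomorphic_imp_open_map)
  moreover have "openin (top_of_set D) V"
    using assms(2,3) by (simp add: open_subset)
  ultimately show ?thesis
    by (meson open_map_def openin_open_subtopology)
qed

lemma local_param_inj_on: "local_param M (D, X) \<Longrightarrow> inj_on X D"
  using homeomorphic_imp_injective_map by (fastforce simp: local_param_def)

lemma open_overlap:
  assumes "local_param M (D, X)" "local_param M (D', Y)"
  shows "open (overlap (D, X) (D', Y))"
proof -
  have D: "open D" "openin M (Y ` D')"
    "continuous_map (top_of_set D) (subtopology M (X ` D)) X"
    using assms by (auto simp: local_param_def homeomorphic_imp_continuous_map)
  have "openin (subtopology M (X ` D)) (Y ` D' \<inter> X ` D)"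
    using D(2) by (auto simp: openin_subtopology)
  from openin_continuous_map_preimage[OF D(3) this]
  have "openin (top_of_set D) (overlap (D, X) (D', Y))"
    by (rule back_subst[where P="openin (top_of_set D)"]) (auto simp: overlap_def)
  then show ?thesis
    using D(1) openin_open_eq by blast
qed

lemma transition_props:
  assumes "p \<in> overlap (D, X) (D', Y)"
  shows "transition (D, X) (D', Y) p \<in> D'" "Y (transition (D, X) (D', Y) p) = X p"
  using assms by (auto simp: overlap_def transition_def inv_into_into f_inv_into_f)

text \<open>The two transitions are inverse to each other, so the chain rule gives a left inverse of the
  derivative.\<close>

lemma inj_transition_derivative:
  assumes X: "local_param M (D, X)" and Y: "local_param M (D', Y)"
    and sm: "smooth_on (overlap (D, X) (D', Y)) (transition (D, X) (D', Y))"
      "smooth_on (overlap (D', Y) (D, X)) (transition (D', Y) (D, X))"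
    and p: "p \<in> overlap (D, X) (D', Y)"
  shows "inj (frechet_derivative (transition (D, X) (D', Y)) (at p))"
proof -
  define \<tau> \<sigma> where "\<tau> = transition (D, X) (D', Y)" and "\<sigma> = transition (D', Y) (D, X)"
  have \<tau>q: "\<tau> q \<in> overlap (D', Y) (D, X)" "\<sigma> (\<tau> q) = q" if "q \<in> overlap (D, X) (D', Y)" for q
  proof -
    have q: "q \<in> D"
      using that by (auto simp: overlap_def)
    show o: "\<tau> q \<in> overlap (D', Y) (D, X)"
      using transition_props[OF that] q by (auto simp: overlap_def \<tau>_def)
    show "\<sigma> (\<tau> q) = q"
      using inj_onD[OF local_param_inj_on[OF X] _ transition_props(1)[OF o] q]
        transition_props(2)[OF that] transition_props(2)[OF o]
      by (simp add: \<sigma>_def \<tau>_def)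
  qed
  have d: "(\<tau> has_derivative frechet_derivative \<tau> (at p)) (at p)"
    "(\<sigma> has_derivative frechet_derivative \<sigma> (at (\<tau> p))) (at (\<tau> p))"
    using smooth_on_has_derivative[OF sm(1) p] smooth_on_has_derivative[OF sm(2) \<tau>q(1)[OF p]]
    by (simp_all add: \<tau>_def \<sigma>_def)
  from has_derivative_compose[OF this]
  have "((\<lambda>q. q) has_derivative
      (\<lambda>w. frechet_derivative \<sigma> (at (\<tau> p)) (frechet_derivative \<tau> (at p) w))) (at p)"
    by (rule has_derivative_transform_within_open[OF _ open_overlap[OF X Y] p]) (use \<tau>q in auto)
  then have "(\<lambda>w. frechet_derivative \<sigma> (at (\<tau> p)) (frechet_derivative \<tau> (at p) w)) = (\<lambda>w. w)"
    using has_derivative_unique[OF _ has_derivative_ident] by blast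
  then show ?thesis
    unfolding \<tau>_def[symmetric] by (intro inj_on_inverseI[of _ "frechet_derivative \<sigma> (at (\<tau> p))"]) (rule fun_cong)
qed

lemma conformal_to_form_near_change_param:
  assumes X: "local_param M (D, X)" and Y: "local_param M (D', Y)"
    and sm: "smooth_on (overlap (D, X) (D', Y)) (transition (D, X) (D', Y))"
      "smooth_on (overlap (D', Y) (D, X)) (transition (D', Y) (D, X))"
    and p: "p \<in> D" "q \<in> D'" "X p = Y q"
    and conf: "conformal_to_form_near (f \<circ> Y) q"
  shows "conformal_to_form_near (f \<circ> X) p"
proof -
  have o: "p \<in> overlap (D, X) (D', Y)"
    using p by (auto simp: overlap_def)
  then have q: "transition (D, X) (D', Y) p = q"
    using transition_props[OF o] p local_param_inj_on[OF Y] by (auto simp: inj_on_def)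
  show ?thesis
  proof (rule conformal_to_form_near_transport[OF _ open_overlap[OF X Y] o sm(1)])
    show "conformal_to_form_near (f \<circ> Y) (transition (D, X) (D', Y) p)"
      using conf q by simp
    show "inj (frechet_derivative (transition (D, X) (D', Y)) (at p))"
      by (rule inj_transition_derivative[OF X Y sm o])
    show "(f \<circ> X) r = (f \<circ> Y) (transition (D, X) (D', Y) r)" if "r \<in> overlap (D, X) (D', Y)" for r
      using transition_props(2)[OF that] by simp
  qed
qed

section \<open>Maxfaces and minfaces\<close>

text \<open>The points where conformality fails form an open set of parameters, whose image is open in the
  surface. If it were nonempty, it would meet the dense set on which conformality is assumed.\<close>

lemma maxface_conformal_at:
  assumes f: "maxface M A f" and Y: "(D, Y) \<in> A" "q \<in> D"
  shows "conformal_at (f \<circ> Y) q"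
proof (rule ccontr)
  assume non: "\<not> conformal_at (f \<circ> Y) q"
  have lp: "local_param M (D, Y)"
    using f Y(1) unfolding maxface_def riemann_surface_def smooth_surface_def by blast
  have sm: "smooth_on D (f \<circ> Y)"
    using f Y(1) unfolding maxface_def smooth_map_def by blast
  have D: "open D"
    using lp by (simp add: local_param_def)
  obtain W where "open_dense_in M W"
    and W: "\<forall>(D, X)\<in>A. \<forall>p\<in>D. X p \<in> W \<longrightarrow>
        spacelike_immersion_at (f \<circ> X) p \<and> conformal_at (f \<circ> X) p \<and>
        mean_curvature (f \<circ> X) p = 0"
    using f[unfolded maxface_def, THEN conjunct2, THEN conjunct2, THEN conjunct1]
    by (elim exE conjE) (rule that; assumption)
  then have dense: "M closure_of W = topspace M"
    by (simp add: open_dense_in_def)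
  have conf: "conformal_at (f \<circ> Y) p" if "p \<in> D" "Y p \<in> W" for p
    using bspec[OF W Y(1)] that by auto
  let ?l = "\<lambda>i j p. lorentz (i (f \<circ> Y) p) (j (f \<circ> Y) p) :: real"
  \<comment> \<open>the points where conformality fails, as the preimage of an open set\<close>
  define N where "N = {p \<in> D. (?l pd1 pd1 p - ?l pd2 pd2 p, ?l pd1 pd2 p) \<noteq> (0, 0)}"
  have N_iff: "p \<in> N \<longleftrightarrow> p \<in> D \<and> \<not> conformal_at (f \<circ> Y) p" for p
    by (auto simp: N_def conformal_at_def)
  have "continuous_on D (pd1 (f \<circ> Y))" "continuous_on D (pd2 (f \<circ> Y))"
    using smooth_on_pd1[OF D sm] smooth_on_pd2[OF D sm]
    by (auto intro!: continuous_at_imp_continuous_on smooth_on_isCont)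
  then have "continuous_on D (\<lambda>p. (?l pd1 pd1 p - ?l pd2 pd2 p, ?l pd1 pd2 p))"
    by (intro continuous_intros bounded_bilinear.continuous_on[OF bounded_bilinear_lorentz])
  then have "open (D \<inter> (\<lambda>p. (?l pd1 pd1 p - ?l pd2 pd2 p, ?l pd1 pd2 p)) -` (- {(0, 0)}))"
    using D by (intro continuous_open_preimage) auto
  moreover have "D \<inter> (\<lambda>p. (?l pd1 pd1 p - ?l pd2 pd2 p, ?l pd1 pd2 p)) -` (- {(0, 0)}) = N"
    by (auto simp: N_def)
  ultimately have "open N"
    by simp
  then have "openin M (Y ` N)"
    by (rule local_param_openin_image[OF lp]) (auto simp: N_def)
  moreover have "Y q \<in> Y ` N"
    using non Y(2) N_iff by blast
  moreover have "Y q \<in> M closure_of W"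
    using calculation dense openin_subset by blast
  ultimately obtain p where "p \<in> N" "Y p \<in> W"
    unfolding in_closure_of by blast
  then show False
    using conf N_iff by blast
qed

lemma maxface_conformal_to_form_near:
  assumes f: "maxface M A f" and Y: "(D, Y) \<in> A" "q \<in> D"
  shows "conformal_to_form_near (f \<circ> Y) q"
proof -
  have lp: "local_param M (D, Y)"
    using f Y(1) unfolding maxface_def riemann_surface_def smooth_surface_def by blast
  have sm: "smooth_on D (f \<circ> Y)"
    using f Y(1) unfolding maxface_def smooth_map_def by blast
  have D: "open D"
    using lp by (simp add: local_param_def)
  have form: "lorentz (frechet_derivative (f \<circ> Y) (at p) w) (frechet_derivative (f \<circ> Y) (at p) w)
      = lorentz (pd1 (f \<circ> Y) p) (pd1 (f \<circ> Y) p) * qform 1 0 1 w" if "p \<in> D" for p w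
  proof -
    note d = smooth_on_has_derivative[OF sm that]
    have "frechet_derivative (f \<circ> Y) (at p) w = fst w *\<^sub>R pd1 (f \<circ> Y) p + snd w *\<^sub>R pd2 (f \<circ> Y) p"
      using linear_plane[OF has_derivative_linear[OF d]] pd1_eq_derivative[OF d] pd2_eq_derivative[OF d]
      by metis
    then show ?thesis
      using maxface_conformal_at[OF f Y(1) that]
      by (simp add: lorentz_combination conformal_at_def qform_def algebra_simps)
  qed
  have pos: "w = 0" if "qform 1 0 1 w = 0" for w
    using that by (simp add: qform_def sum_power2_eq_zero_iff prod_eq_iff)
  show ?thesis
    unfolding conformal_to_form_near_def
  proof (intro exI conjI ballI allI)
    show "f \<circ> Y differentiable at p" if "p \<in> D" for p
      using smooth_on_has_derivative[OF sm that] differentiableI by blast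
  qed (use D Y form pos in auto)
qed

text \<open>Here the form is \<open>du dv\<close>, because \<open>\<langle>\<phi>', \<phi>'\<rangle> = \<langle>\<psi>', \<psi>'\<rangle> = 0\<close> leaves only the mixed term
  \<open>2 \<langle>\<phi>', \<psi>'\<rangle> du dv\<close>.\<close>

lemma null_translation_conformal_to_form_near:
  fixes \<phi> \<psi> :: "real \<Rightarrow> real^3"
  assumes "open J" "open K" and q: "q \<in> J \<times> K"
    and \<phi>: "smooth_on J \<phi>" "\<And>u. u \<in> J \<Longrightarrow> light_like (vector_derivative \<phi> (at u))"
    and \<psi>: "smooth_on K \<psi>" "\<And>v. v \<in> K \<Longrightarrow> light_like (vector_derivative \<psi> (at v))"
    and F: "\<And>u v. u \<in> J \<Longrightarrow> v \<in> K \<Longrightarrow> F (u, v) = \<phi> u + \<psi> v"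
  shows "conformal_to_form_near F q"
proof -
  define a b where "a p = vector_derivative \<phi> (at (fst p))"
    and "b p = vector_derivative \<psi> (at (snd p))" for p :: "real \<times> real"
  have DF: "(F has_derivative (\<lambda>w. fst w *\<^sub>R a p + snd w *\<^sub>R b p)) (at p)" if p: "p \<in> J \<times> K" for p
  proof -
    have "\<phi> differentiable (at (fst p))" "\<psi> differentiable (at (snd p))"
      using differentiableI[OF smooth_on_has_derivative[OF \<phi>(1)]]
        differentiableI[OF smooth_on_has_derivative[OF \<psi>(1)]] p
      by (simp_all add: mem_Times_iff)
    then have "(\<phi> has_derivative (\<lambda>h. h *\<^sub>R a p)) (at (fst p))"
      "(\<psi> has_derivative (\<lambda>h. h *\<^sub>R b p)) (at (snd p))"
      unfolding a_def b_def has_vector_derivative_def[symmetric] vector_derivative_works .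
    note has_derivative_add[OF has_derivative_compose[OF has_derivative_fst[OF has_derivative_ident] this(1)]
        has_derivative_compose[OF has_derivative_snd[OF has_derivative_ident] this(2)]]
    then show ?thesis
      by (rule has_derivative_transform_within_open[OF _ open_Times[OF assms(1,2)] p])
        (use F in auto)
  qed
  have dF: "frechet_derivative F (at p) = (\<lambda>w. fst w *\<^sub>R a p + snd w *\<^sub>R b p)"
    if "p \<in> J \<times> K" for p
    by (rule frechet_derivative_at[OF DF[OF that], symmetric])
  have null: "light_like (a p)" "light_like (b p)" if "p \<in> J \<times> K" for p
    using that \<phi>(2) \<psi>(2) by (auto simp: a_def b_def)
  show ?thesis
    unfolding conformal_to_form_near_def
  proof (intro exI conjI ballI allI impI)
    fix p w
    assume p: "p \<in> J \<times> K"
    show "F differentiable (at p)"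
      using DF[OF p] differentiableI by blast
    show "lorentz (frechet_derivative F (at p) w) (frechet_derivative F (at p) w)
        = (2 * lorentz (a p) (b p)) * qform 0 (1/2) 0 w"
      using null[OF p] by (simp add: dF[OF p] lorentz_combination light_like_def qform_def)
  next
    fix w
    assume "w \<noteq> 0 \<and> qform 0 (1/2) 0 w = 0"
    then have "fst w = 0 \<and> snd w \<noteq> 0 \<or> fst w \<noteq> 0 \<and> snd w = 0"
      by (auto simp: qform_def prod_eq_iff)
    then show "frechet_derivative F (at q) w \<noteq> 0"
      using null[OF q] by (auto simp: dF[OF q] light_like_def)
  qed (use assms in \<open>auto intro: open_Times\<close>)
qed

text \<open>Null coordinates of a minface are only known to be compatible with the charts of the atlas, so the
  passage from them to the given coordinates goes through a chart around the point: the form is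
  transported twice.\<close>

lemma smooth_coordinates_conformal_to_form_near:
  assumes f: "maxface M A f \<or> minface M A f"
    and X: "smooth_coordinates M A (D, X)" and p: "p \<in> D"
  shows "conformal_to_form_near (f \<circ> X) p"
proof -
  have lpX: "local_param M (D, X)"
    and smX: "\<And>Q. Q \<in> A \<Longrightarrow> smooth_on (overlap (D, X) Q) (transition (D, X) Q)"
      "\<And>Q. Q \<in> A \<Longrightarrow> smooth_on (overlap Q (D, X)) (transition Q (D, X))"
    using X by (auto simp: smooth_coordinates_def)
  have surf: "smooth_surface M A"
    using f by (auto simp: maxface_def minface_def riemann_surface_def)
  have "X p \<in> topspace M"
    using lpX p openin_subset by (fastforce simp: local_param_def)
  moreover have "topspace M = (\<Union>(D, X)\<in>A. X ` D)"
    using surf by (simp add: smooth_surface_def)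
  ultimately obtain E Z q where Z: "(E, Z) \<in> A" "q \<in> E" "X p = Z q"
    by auto
  have lpZ: "local_param M (E, Z)"
    using surf Z(1) by (auto simp: smooth_surface_def)
  have "conformal_to_form_near (f \<circ> Z) q"
    using f
  proof
    assume "maxface M A f"
    then show ?thesis
      using maxface_conformal_to_form_near Z by blast
  next
    assume "minface M A f"
    note null_coordinates = this[unfolded minface_def, THEN conjunct2, THEN conjunct2, THEN conjunct2,
        THEN bspec, OF \<open>X p \<in> topspace M\<close>]
    from null_coordinates obtain J K Y \<phi> \<psi> where
      JK: "open_interval J" "open_interval K"
      and Y: "smooth_coordinates M A (J \<times> K, Y)" "X p \<in> Y ` (J \<times> K)"
      and \<phi>: "regular_curve J \<phi>" "\<forall>u\<in>J. light_like (vector_derivative \<phi> (at u))"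
      and \<psi>: "regular_curve K \<psi>" "\<forall>v\<in>K. light_like (vector_derivative \<psi> (at v))"
      and fY: "\<forall>u\<in>J. \<forall>v\<in>K. f (Y (u, v)) = \<phi> u + \<psi> v"
      by (elim exE conjE) (rule that; assumption)
    obtain r where r: "r \<in> J \<times> K" "X p = Y r"
      using Y(2) by blast
    have "conformal_to_form_near (f \<circ> Y) r"
      by (rule null_translation_conformal_to_form_near[of J K r \<phi> \<psi>])
        (use JK \<phi> \<psi> fY r in \<open>auto simp: open_interval_def regular_curve_def\<close>)
    moreover have "local_param M (J \<times> K, Y)"
      "smooth_on (overlap (E, Z) (J \<times> K, Y)) (transition (E, Z) (J \<times> K, Y))"
      "smooth_on (overlap (J \<times> K, Y) (E, Z)) (transition (J \<times> K, Y) (E, Z))"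
      using Y(1) Z(1) unfolding smooth_coordinates_def by blast+
    ultimately show ?thesis
      using conformal_to_form_near_change_param[OF lpZ _ _ _ Z(2) r(1)] r(2) Z(3) by simp
  qed
  then show ?thesis
    using conformal_to_form_near_change_param[OF lpX lpZ smX[OF Z(1)] p Z(2,3)] by blast
qed

section \<open>Cuspidal edges\<close>

lemma smooth_on_Delta_L:
  assumes "open S" "smooth_on S F"
  shows "smooth_on S (Delta_L F)"
proof -
  note L = smooth_on_bilinear[OF bounded_bilinear_lorentz assms(1)]
  note d = smooth_on_pd1[OF assms] smooth_on_pd2[OF assms]
  have minus_mult: "bounded_bilinear (\<lambda>x y. - (x * y) :: real)"
  proof
    show "\<exists>K. \<forall>x y :: real. norm (- (x * y)) \<le> norm x * norm y * K"
      by (rule exI[of _ 1]) (simp add: abs_mult)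
  qed (simp_all add: algebra_simps)
  have "smooth_on S (\<lambda>p. lorentz (pd1 F p) (pd1 F p) * lorentz (pd2 F p) (pd2 F p)
      + - (lorentz (pd1 F p) (pd2 F p) * lorentz (pd1 F p) (pd2 F p)))"
    by (rule smooth_on_add[OF assms(1)] smooth_on_bilinear[OF bounded_bilinear_mult assms(1)]
        smooth_on_bilinear[OF minus_mult assms(1)] L d)+
  then show ?thesis
    by (rule smooth_on_cong[OF assms(1), rotated]) (simp add: Delta_L_def power2_eq_square)
qed

text \<open>On the edge \<open>f\<^sub>t = 0\<close>, so \<open>\<partial>\<^sub>t\<close> is not null for the form and the multiplier \<open>\<rho>\<close> can be eliminated in favour
  of \<open>\<langle>f\<^sub>t, f\<^sub>t\<rangle>\<close>. All three coefficients of the first fundamental form then vanish at least as fast as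
  \<open>\<langle>f\<^sub>t, f\<^sub>t\<rangle>\<close>, and the claims come from comparing leading terms in \<open>t\<close>.\<close>

lemma cuspidal_edge_of_form:
  assumes edge: "generalized_cuspidal_edge I \<delta> \<Gamma> F" and s: "s \<in> I"
    and conf: "conformal_to_form_near F (s, 0)"
  shows "light_like (vector_derivative \<Gamma> (at s)) \<and> order_at F s = 4"
proof -
  define S where "S = I \<times> {-\<delta><..<\<delta>}"
  have I: "open I" and \<delta>: "\<delta> > 0" and sm: "smooth_on S F"
    and \<Gamma>: "\<And>s. s \<in> I \<Longrightarrow> \<Gamma> s = F (s, 0)" "vector_derivative \<Gamma> (at s) \<noteq> 0"
    and Ft0: "pd2 F (s, 0) = 0"
    and ind: "pd2 (pd2 F) (s, 0) \<noteq> vector_derivative \<Gamma> (at s)"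
      "independent {pd2 (pd2 F) (s, 0), vector_derivative \<Gamma> (at s)}"
    using edge s unfolding generalized_cuspidal_edge_def open_interval_def regular_curve_def S_def
    by auto
  have S: "open S" and s0: "(s, 0) \<in> S"
    using I s \<delta> by (auto simp: S_def open_Times)
  define Fs Ft Ftt where "Fs t = pd1 F (s, t)" and "Ft t = pd2 F (s, t)"
    and "Ftt = pd2 (pd2 F) (s, 0)" for t
  have \<Gamma>': "vector_derivative \<Gamma> (at s) = Fs 0"
  proof -
    note d = smooth_on_has_derivative[OF sm s0]
    have "((\<lambda>x. F (x, 0)) has_vector_derivative Fs 0) (at s)"
      using has_vector_derivative_partial1[OF d] pd1_eq_derivative[OF d] by (simp add: Fs_def)
    then have "(\<Gamma> has_vector_derivative Fs 0) (at s)"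
      by (rule has_vector_derivative_transform_within_open[OF _ I s]) (use \<Gamma> in auto)
    then show ?thesis
      by (rule vector_derivative_at)
  qed
  obtain U e m g \<rho> where U: "open U" "(s, 0) \<in> U"
    and cont: "isCont e (s, 0)" "isCont m (s, 0)" "isCont g (s, 0)"
    and nondeg: "e (s, 0) * g (s, 0) - (m (s, 0))\<^sup>2 \<noteq> 0"
    and form: "\<And>q w. q \<in> U \<Longrightarrow> lorentz (frechet_derivative F (at q) w) (frechet_derivative F (at q) w)
              = \<rho> q * qform (e q) (m q) (g q) w"
    and null: "\<And>w. w \<noteq> 0 \<Longrightarrow> qform (e (s, 0)) (m (s, 0)) (g (s, 0)) w = 0 \<Longrightarrow>
              frechet_derivative F (at (s, 0)) w \<noteq> 0"
    using conf unfolding conformal_to_form_near_def by blast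
  define \<epsilon> \<mu> \<gamma> where "\<epsilon> t = e (s, t)" and "\<mu> t = m (s, t)" and "\<gamma> t = g (s, t)" for t
  have pair: "isCont (\<lambda>t. (s, t)) (0::real)"
    by (intro continuous_intros)
  have c0: "isCont \<epsilon> 0" "isCont \<mu> 0" "isCont \<gamma> 0"
    unfolding \<epsilon>_def \<mu>_def \<gamma>_def using isCont_o2[OF pair] cont by auto
  \<comment> \<open>the differential kills \<open>(0, 1)\<close>, which therefore is not null for the form\<close>
  have \<gamma>0: "\<gamma> 0 \<noteq> 0"
  proof
    assume "\<gamma> 0 = 0"
    then have "qform (e (s, 0)) (m (s, 0)) (g (s, 0)) (0, 1) = 0"
      by (simp add: qform_def \<gamma>_def)
    then have "frechet_derivative F (at (s, 0)) (0, 1) \<noteq> 0"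
      by (intro null) (simp_all add: zero_prod_def)
    then show False
      using Ft0 pd2_eq_derivative[OF smooth_on_has_derivative[OF sm s0]] by simp
  qed
  have evU: "eventually (\<lambda>t. (s, t) \<in> U \<inter> S \<and> \<gamma> t \<noteq> 0) (nhds 0)"
  proof -
    have "((\<lambda>t. (s, t)) \<longlongrightarrow> (s, 0)) (nhds (0::real))"
      using pair by (simp add: isCont_def tendsto_at_iff_tendsto_nhds)
    then have "eventually (\<lambda>t. (s, t) \<in> U \<inter> S) (nhds 0)"
      by (rule topological_tendstoD) (use U S s0 in auto)
    moreover have "(\<gamma> \<longlongrightarrow> \<gamma> 0) (nhds 0)"
      using c0(3) by (simp add: isCont_def tendsto_at_iff_tendsto_nhds)
    then have "eventually (\<lambda>t. \<gamma> t \<noteq> 0) (nhds 0)"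
      using \<gamma>0 by (rule tendsto_imp_eventually_ne)
    ultimately show ?thesis
      by eventually_elim auto
  qed
  have rel: "lorentz (Fs t) (Fs t) = \<epsilon> t / \<gamma> t * lorentz (Ft t) (Ft t)"
    "lorentz (Fs t) (Ft t) = \<mu> t / \<gamma> t * lorentz (Ft t) (Ft t)"
    if t: "(s, t) \<in> U \<inter> S \<and> \<gamma> t \<noteq> 0" for t
  proof -
    have d: "(F has_derivative frechet_derivative F (at (s, t))) (at (s, t))"
      using smooth_on_has_derivative[OF sm] t by blast
    have "frechet_derivative F (at (s, t)) w = fst w *\<^sub>R Fs t + snd w *\<^sub>R Ft t" for w
      using linear_plane[OF has_derivative_linear[OF d]] pd1_eq_derivative[OF d] pd2_eq_derivative[OF d]
      unfolding Fs_def Ft_def by metis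
    then have q: "(fst w)\<^sup>2 * lorentz (Fs t) (Fs t) + 2 * fst w * snd w * lorentz (Fs t) (Ft t)
        + (snd w)\<^sup>2 * lorentz (Ft t) (Ft t) = \<rho> (s, t) * qform (\<epsilon> t) (\<mu> t) (\<gamma> t) w" for w
      using form[of "(s, t)" w] t by (simp add: lorentz_combination \<epsilon>_def \<mu>_def \<gamma>_def)
    have "lorentz (Fs t) (Fs t) = \<rho> (s, t) * \<epsilon> t" "lorentz (Ft t) (Ft t) = \<rho> (s, t) * \<gamma> t"
      using q[of "(1, 0)"] q[of "(0, 1)"] by (simp_all add: qform_def)
    \<comment> \<open>polarization\<close>
    moreover from this have "lorentz (Fs t) (Ft t) = \<rho> (s, t) * \<mu> t"
      using q[of "(1, 1)"] by (simp add: qform_def algebra_simps)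
    ultimately show "lorentz (Fs t) (Fs t) = \<epsilon> t / \<gamma> t * lorentz (Ft t) (Ft t)"
        "lorentz (Fs t) (Ft t) = \<mu> t / \<gamma> t * lorentz (Ft t) (Ft t)"
      using t by simp_all
  qed
  have ev: "eventually (\<lambda>t. (s, t) \<in> U \<inter> S \<and> \<gamma> t \<noteq> 0 \<and> t \<noteq> 0) (at 0)"
    using evU by (auto simp: eventually_at_filter elim: eventually_mono)
  note lim_lorentz = bounded_bilinear.tendsto[OF bounded_bilinear_lorentz]
  interpret lor: bounded_bilinear lorentz
    by (rule bounded_bilinear_lorentz)
  have Ft_lim: "((\<lambda>t. Ft t /\<^sub>R t) \<longlongrightarrow> Ftt) (at 0)"
  proof -
    have "(Ft has_vector_derivative Ftt) (at 0)"
      unfolding Ft_def Ftt_def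
      by (rule has_vector_derivative_pd2[OF smooth_on_pd2[OF S sm] s0])
    then have "((\<lambda>t. norm (Ft (0 + t) - Ft 0 - t *\<^sub>R Ftt) / norm t) \<longlongrightarrow> 0) (at 0)"
      unfolding has_vector_derivative_def has_derivative_at by blast
    moreover have "norm (Ft (0 + t) - Ft 0 - t *\<^sub>R Ftt) / norm t = norm (Ft t /\<^sub>R t - Ftt)"
      if "t \<noteq> 0" for t
    proof -
      have "Ft (0 + t) - Ft 0 - t *\<^sub>R Ftt = t *\<^sub>R (Ft t /\<^sub>R t - Ftt)"
        using that Ft0 by (simp add: Ft_def scaleR_diff_right)
      then show ?thesis
        using that by simp
    qed
    then have "eventually (\<lambda>t. norm (Ft (0 + t) - Ft 0 - t *\<^sub>R Ftt) / norm t
        = norm (Ft t /\<^sub>R t - Ftt)) (at 0)"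
      by (simp add: eventually_at_filter)
    ultimately have "((\<lambda>t. norm (Ft t /\<^sub>R t - Ftt)) \<longlongrightarrow> 0) (at 0)"
      by (rule Lim_transform_eventually)
    then show ?thesis
      by (rule LIM_zero_cancel[OF tendsto_norm_zero_cancel])
  qed
  have Fs_lim: "(Fs \<longlongrightarrow> Fs 0) (at 0)"
    using isCont_o2[OF pair smooth_on_isCont[OF smooth_on_pd1[OF S sm] s0]]
    by (simp add: Fs_def[abs_def] isCont_def)
  have Ft_0: "(Ft \<longlongrightarrow> 0) (at 0)"
    using isCont_o2[OF pair smooth_on_isCont[OF smooth_on_pd2[OF S sm] s0]] Ft0
    by (simp add: Ft_def[abs_def] isCont_def)
  have c: "(\<epsilon> \<longlongrightarrow> \<epsilon> 0) (at 0)" "(\<mu> \<longlongrightarrow> \<mu> 0) (at 0)" "(\<gamma> \<longlongrightarrow> \<gamma> 0) (at 0)"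
    using c0 by (auto simp: isCont_def)
  have "lorentz (Fs 0) (Fs 0) = 0"
    using rel(1)[OF eventually_nhds_x_imp_x[OF evU]] Ft0 by (simp add: Ft_def lor.zero_left)
  then have LL: "light_like (Fs 0)"
    using \<Gamma>(2) \<Gamma>' by (simp add: light_like_def)
  \<comment> \<open>divide \<open>\<langle>F\<^sub>s, F\<^sub>t\<rangle> = (\<mu>/\<gamma>) \<langle>F\<^sub>t, F\<^sub>t\<rangle>\<close> by \<open>t\<close>: the right-hand side keeps a factor \<open>F\<^sub>t\<close>, which tends to \<open>0\<close>\<close>
  have orth: "lorentz (Fs 0) Ftt = 0"
  proof -
    have "((\<lambda>t. lorentz (Fs t) (Ft t /\<^sub>R t)) \<longlongrightarrow> lorentz (Fs 0) Ftt) (at 0)"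
      by (intro lim_lorentz Fs_lim Ft_lim)
    moreover have "((\<lambda>t. lorentz (Fs t) (Ft t /\<^sub>R t)) \<longlongrightarrow>
        \<mu> 0 / \<gamma> 0 * lorentz 0 Ftt) (at 0)"
    proof (rule Lim_transform_eventually)
      show "((\<lambda>t. \<mu> t / \<gamma> t * lorentz (Ft t) (Ft t /\<^sub>R t)) \<longlongrightarrow>
          \<mu> 0 / \<gamma> 0 * lorentz 0 Ftt) (at 0)"
        by (intro tendsto_mult tendsto_divide lim_lorentz Ft_0 Ft_lim c \<gamma>0)
      show "eventually (\<lambda>t. \<mu> t / \<gamma> t * lorentz (Ft t) (Ft t /\<^sub>R t)
          = lorentz (Fs t) (Ft t /\<^sub>R t)) (at 0)"
        using ev by eventually_elim (simp add: lor.scaleR_right rel(2))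
    qed
    ultimately have "lorentz (Fs 0) Ftt = \<mu> 0 / \<gamma> 0 * lorentz 0 Ftt"
      by (rule LIM_unique)
    then show ?thesis
      by (simp add: lor.zero_left)
  qed
  have nn: "lorentz Ftt Ftt \<noteq> 0"
  proof
    assume "lorentz Ftt Ftt = 0"
    then obtain k where "Ftt = k *\<^sub>R Fs 0"
      using null_orthogonal_imp_dependent[OF LL orth] by blast
    then have "dependent {Ftt, Fs 0}"
      using ind(1) \<Gamma>' unfolding dependent_def
      by (intro bexI[of _ Ftt]) (auto simp: Ftt_def span_singleton insert_Diff_if)
    then show False
      using ind(2) \<Gamma>' by (simp add: Ftt_def)
  qed
  define h where "h k t = (pd2 ^^ k) (Delta_L F) (s, t)" for k t
  \<comment> \<open>the coefficient of \<open>t\<^sup>4\<close> in \<open>\<Delta>\<^sub>L = (\<epsilon>/\<gamma> - (\<mu>/\<gamma>)\<^sup>2) \<langle>F\<^sub>t, F\<^sub>t\<rangle>\<^sup>2\<close>\<close>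
  define L where "L = (\<epsilon> 0 / \<gamma> 0 - (\<mu> 0 / \<gamma> 0)\<^sup>2) * (lorentz Ftt Ftt)\<^sup>2"
  have "\<epsilon> 0 / \<gamma> 0 - (\<mu> 0 / \<gamma> 0)\<^sup>2 = (\<epsilon> 0 * \<gamma> 0 - (\<mu> 0)\<^sup>2) / (\<gamma> 0)\<^sup>2"
    using \<gamma>0 by (simp add: field_simps power2_eq_square)
  then have L: "L \<noteq> 0"
    using nn nondeg \<gamma>0 by (simp add: L_def \<epsilon>_def \<mu>_def \<gamma>_def)
  have h_lim: "((\<lambda>t. h 0 t / t ^ 4) \<longlongrightarrow> L) (at 0)"
  proof (rule Lim_transform_eventually)
    show "((\<lambda>t. (\<epsilon> t / \<gamma> t - (\<mu> t / \<gamma> t)\<^sup>2) * (lorentz (Ft t /\<^sub>R t) (Ft t /\<^sub>R t))\<^sup>2) \<longlongrightarrow> L) (at 0)"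
      unfolding L_def by (intro tendsto_intros lim_lorentz Ft_lim c \<gamma>0)
    show "eventually (\<lambda>t. (\<epsilon> t / \<gamma> t - (\<mu> t / \<gamma> t)\<^sup>2) * (lorentz (Ft t /\<^sub>R t) (Ft t /\<^sub>R t))\<^sup>2
        = h 0 t / t ^ 4) (at 0)"
      using ev
    proof eventually_elim
      case (elim t)
      have "h 0 t = (\<epsilon> t / \<gamma> t - (\<mu> t / \<gamma> t)\<^sup>2) * (lorentz (Ft t) (Ft t))\<^sup>2"
        using rel[of t] elim
        by (simp add: h_def Delta_L_def Fs_def Ft_def power2_eq_square algebra_simps)
      moreover have "lorentz (Ft t /\<^sub>R t) (Ft t /\<^sub>R t) = lorentz (Ft t) (Ft t) / t\<^sup>2"
        by (simp add: lor.scaleR_right lor.scaleR_left divide_inverse power2_eq_square)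
      ultimately show ?case
        by (simp add: power_divide flip: power_mult)
    qed
  qed
  have "(h k has_real_derivative h (Suc k) t) (at t)" if "\<bar>t\<bar> < \<delta>" for k t
    using has_vector_derivative_pd2[OF smooth_on_pd2_iterate[OF S smooth_on_Delta_L[OF S sm]], of s t k] that s
    by (auto simp: h_def[abs_def] S_def abs_less_iff has_real_derivative_iff_has_vector_derivative)
  from derivatives_from_leading_term[OF \<delta> this h_lim]
  have h: "\<And>k. k < 4 \<Longrightarrow> h k 0 = 0" "h 4 0 \<noteq> 0"
    using L by auto
  have "(LEAST k. h k 0 \<noteq> 0) = 4"
    by (rule Least_equality) (use h in \<open>auto simp: not_less[symmetric]\<close>)
  then have "order_at F s = 4"
    using h(2) by (auto simp: order_at_def h_def numeral_eq_enat)
  then show ?thesis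
    using LL \<Gamma>' by simp
qed

theorem proposition5p7:
  fixes M :: "'a topology" and A :: "'a param set" and f :: "'a \<Rightarrow> real^3"
    and X :: "real \<times> real \<Rightarrow> 'a" and I :: "real set" and \<delta> :: real
    and \<Gamma> :: "real \<Rightarrow> real^3"
  assumes "maxface M A f \<or> minface M A f"
    and "smooth_coordinates M A (I \<times> {-\<delta><..<\<delta>}, X)"
    and "generalized_cuspidal_edge I \<delta> \<Gamma> (f \<circ> X)"
  shows "\<forall>s\<in>I. light_like (vector_derivative \<Gamma> (at s)) \<and> order_at (f \<circ> X) s = 4"
proof
  fix s
  assume s: "s \<in> I"
  moreover have "\<delta> > 0"
    using assms(3) by (simp add: generalized_cuspidal_edge_def)
  ultimately have "conformal_to_form_near (f \<circ> X) (s, 0)"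
    using smooth_coordinates_conformal_to_form_near[OF assms(1,2)] by simp
  then show "light_like (vector_derivative \<Gamma> (at s)) \<and> order_at (f \<circ> X) s = 4"
    using cuspidal_edge_of_form[OF assms(3) s] by blast
qed

end
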